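(* (i) $\mathcal{C}\setminus\mathcal{C}'$ is not a subset of $\mathcal{L}\setminus\mathcal{S}$. (ii) $\mathcal{C}_3\setminus\mathcal{C}'_3$ is a proper subset of $\mathcal{L}\setminus\mathcal{S}$.
   Context: For an integer base $g\ge2$ and integer $m\ge0$, $s_g(m)$ denotes the sum of base-$g$ digits of $m$; $s_1(m):=0$. $\mathcal{L}$ is the set of positive integers $m$ having a divisor $g$ with $s_g(m)=g$. A positive integer $m$ has a strict $s$-decomposition if $m=\prod_{\nu=1}^n g_\nu^{e_\nu}$ with exponents $e_\nu\ge1$ and proper factors $1<g_\nu<m$, strictly increasing $g_1<\dots<g_n$ (not necessarily coprime), with $s_{g_\nu}(m)=g_\nu$ for each $\nu$; $\mathcal{S}$ is the set of such $m$. $\mathcal{C}$ is the set of Carmichael numbers (composite positive $m$ with $a^{m-1}\equiv1\pmod m$ for all $a$ coprime to $m$), $\mathcal{C}_3$ those with exactly three prime factors. $\mathcal{C}'$ is the set of squarefree integers $m>1$ with $s_p(m)=p$ for every prime $p\mid m$, and $\mathcal{C}'_3$ those with exactly three prime factors. *)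

theory Defs
  imports "HOL-Number_Theory.Number_Theory" "HOL-Computational_Algebra.Squarefree"
begin

(* Base-g digit sum. Base 1 has value 0 by convention; base 0 is meaningless and never
   arises below, since no divisor of a positive integer is 0. *)
fun digit_sum :: "nat \<Rightarrow> nat \<Rightarrow> nat" where
  "digit_sum g m = (if g < 2 \<or> m = 0 then 0 else m mod g + digit_sum g (m div g))"

declare digit_sum.simps [simp del]

definition L_set :: "nat set" where
  "L_set = {m. m > 0 \<and> (\<exists>g. g dvd m \<and> digit_sum g m = g)}"

definition strict_s_decomposition :: "nat \<Rightarrow> nat \<Rightarrow> (nat \<Rightarrow> nat) \<Rightarrow> (nat \<Rightarrow> nat) \<Rightarrow> bool" where
  "strict_s_decomposition m n g e \<longleftrightarrow>
     n \<ge> 1 \<and> m = (\<Prod>\<nu>=1..n. g \<nu> ^ e \<nu>) \<and>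
     strict_mono_on {1..n} g \<and>
     (\<forall>\<nu>\<in>{1..n}. e \<nu> \<ge> 1 \<and> 1 < g \<nu> \<and> g \<nu> < m \<and> digit_sum (g \<nu>) m = g \<nu>)"

definition S_set :: "nat set" where
  "S_set = {m. m > 0 \<and> (\<exists>n g e. strict_s_decomposition m n g e)}"

definition carmichael :: "nat \<Rightarrow> bool" where
  "carmichael m \<longleftrightarrow> m > 1 \<and> \<not> prime m \<and>
     (\<forall>a::int. coprime a (int m) \<longrightarrow> [a ^ (m - 1) = 1] (mod int m))"

definition primary_carmichael :: "nat \<Rightarrow> bool" where
  "primary_carmichael m \<longleftrightarrow> m > 1 \<and> squarefree m \<and> (\<forall>p. prime p \<and> p dvd m \<longrightarrow> digit_sum p m = p)"

definition C_set :: "nat set" where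
  "C_set = {m. carmichael m}"

definition C'_set :: "nat set" where
  "C'_set = {m. primary_carmichael m}"

(* "Exactly three prime factors" is counted by distinct primes. Carmichael numbers and the
   elements of C'_set are squarefree, so counting with multiplicity gives the same sets. *)
definition C3_set :: "nat set" where
  "C3_set = {m \<in> C_set. card (prime_factors m) = 3}"

definition C'3_set :: "nat set" where
  "C'3_set = {m \<in> C'_set. card (prime_factors m) = 3}"

end

theory Submission
  imports Defs
begin

text \<open>
  Write \<open>m = pqr\<close> for a Carmichael number with three prime factors, the largest being \<open>r\<close>.
  By Korselt's criterion \<open>pq = 1 + k (r - 1)\<close>, where \<open>2 \<le> k \<le> r\<close> because \<open>pq\<close> is composite
  and smaller than \<open>r\<^sup>2\<close>; hence \<open>pq\<close> has the base-\<open>r\<close> digits \<open>k - 1\<close> and \<open>r + 1 - k\<close>, and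
  \<open>s\<^sub>r(m) = r\<close>. If \<open>g\<close> is a composite proper divisor of \<open>m\<close>, then \<open>h = m / g\<close> is a prime with
  \<open>h - 1\<close> dividing \<open>g - 1\<close>, so \<open>h < g\<close> and \<open>s\<^sub>g(m) = h \<noteq> g\<close>. The factors of a strict
  \<open>s\<close>-decomposition of \<open>m\<close> are therefore primes, which forces \<open>s\<^sub>p(m) = p\<close> for every prime
  \<open>p\<close> dividing \<open>m\<close>. Part (i) is witnessed by \<open>172081 = 7 \<cdot> 13 \<cdot> 31 \<cdot> 61 = 31 \<cdot> 61 \<cdot> 91\<close>, and
  properness in (ii) by \<open>6\<close>.
\<close>

section \<open>Digit sums of multiples of the base\<close>

lemma digit_sum_add_mult:
  assumes "g \<ge> 2" "a < g"
  shows "digit_sum g (a + g * b) = a + digit_sum g b"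
proof (cases "a + g * b = 0")
  case True
  with assms show ?thesis by simp
next
  case False
  with assms show ?thesis by (subst digit_sum.simps) auto
qed

lemma digit_sum_0 [simp]: "digit_sum g 0 = 0"
  by (subst digit_sum.simps) simp

lemma digit_sum_mult_self: "g \<ge> 2 \<Longrightarrow> digit_sum g (g * b) = digit_sum g b"
  using digit_sum_add_mult[of g 0 b] by simp

lemma digit_sum_less:
  assumes "a < g"
  shows "digit_sum g a = a"
proof (cases "g \<ge> 2")
  case True
  with digit_sum_add_mult[of g a 0] assms show ?thesis by simp
next
  case False
  with assms have "a = 0" by linarith
  thus ?thesis by simp
qed

section \<open>Korselt's criterion through the Carmichael function\<close>

lemma prime_minus_1_dvd_Carmichael:
  fixes p m :: nat
  assumes "prime p" "p dvd m" "m > 0"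
  shows "p - 1 dvd Carmichael m"
    and "p ^ 2 dvd m \<Longrightarrow> p dvd Carmichael m"
proof -
  define k where "k = multiplicity p m"
  from assms have "m \<noteq> 0" "\<not> is_unit p" by auto
  then obtain n where n: "m = p ^ k * n" "\<not> p dvd n"
    using multiplicity_decompose'[of m p] unfolding k_def by metis
  have "k > 0"
    using assms unfolding k_def by (simp add: prime_multiplicity_gt_zero_iff)
  \<comment> \<open>The full power of \<open>p\<close> splits off coprimely, and the Carmichael
    function turns a coprime product into an lcm.\<close>
  have "coprime (p ^ k) n"
    using n assms by (auto intro: prime_imp_coprime)
  hence dvd: "Carmichael (p ^ k) dvd Carmichael m"
    by (simp add: n Carmichael_mult_coprime)
  have "p - 1 dvd Carmichael (p ^ k)"
    using assms \<open>k > 0\<close> by (auto simp: Carmichael_prime_power)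
  with dvd show "p - 1 dvd Carmichael m" by (rule dvd_trans[rotated])
  assume "p ^ 2 dvd m"
  hence "k \<ge> 2"
    using assms \<open>\<not> is_unit p\<close> unfolding k_def by (intro multiplicity_geI) auto
  \<comment> \<open>This includes \<open>p = 2\<close>, where the value is 2 for
    \<open>k = 2\<close> and \<open>2 ^ (k - 2)\<close> for larger \<open>k\<close>.\<close>
  hence "p dvd Carmichael (p ^ k)"
    using assms by (auto simp: Carmichael_prime_power)
  with dvd show "p dvd Carmichael m" by (rule dvd_trans[rotated])
qed

text \<open>\<open>Carmichael m\<close> is the exponent of the unit group and is attained as the
  order of some unit, so one divisibility replaces the congruences for all \<open>a\<close>.\<close>

lemma carmichael_iff:
  "carmichael m \<longleftrightarrow> m > 1 \<and> \<not> prime m \<and> Carmichael m dvd m - 1"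
proof (intro iffI conjI)
  assume m: "carmichael m"
  thus "m > 1" "\<not> prime m" by (auto simp: carmichael_def)
  then obtain g where g: "g \<in> totatives m" "ord m g = Carmichael m"
    using Carmichael_root_exists[of m] by auto
  hence "[int g ^ (m - 1) = 1] (mod int m)"
    using m by (simp add: carmichael_def totatives_def)
  hence "[g ^ (m - 1) = 1] (mod m)"
    by (metis cong_int_iff of_nat_1 of_nat_power)
  with g show "Carmichael m dvd m - 1" by (simp add: ord_divides')
next
  assume m: "m > 1 \<and> \<not> prime m \<and> Carmichael m dvd m - 1"
  show "carmichael m"
    unfolding carmichael_def
  proof (intro conjI allI impI)
    fix a :: int assume a: "coprime a (int m)"
    \<comment> \<open>The definition ranges over integers; passing to the residue \<open>b\<close>
      makes \<open>Carmichael_divides\<close> applicable.\<close>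
    define b where "b = nat (a mod int m)"
    have b: "int b = a mod int m" using m by (simp add: b_def)
    from a have "coprime (int b) (int m)" using m by (simp add: b)
    hence "[b ^ (m - 1) = 1] (mod m)"
      using m by (intro Carmichael_divides) (auto simp: coprime_commute)
    hence "[int b ^ (m - 1) = 1] (mod int m)"
      by (metis cong_int_iff of_nat_1 of_nat_power)
    moreover have "[int b ^ (m - 1) = a ^ (m - 1)] (mod int m)"
      by (intro cong_pow) (simp add: b)
    ultimately show "[a ^ (m - 1) = 1] (mod int m)"
      by (metis cong_sym cong_trans)
  qed (use m in auto)
qed

text \<open>Korselt's condition \<open>p - 1 dvd p * n - 1\<close> moves to the cofactor because
  \<open>p\<close> is 1 modulo \<open>p - 1\<close>.\<close>

lemma carmichael_prime_dvd:
  assumes "carmichael (p * n)" "prime p"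
  shows "p - 1 dvd n - 1"
proof -
  have pos: "p > 1" "p * n > 1"
    using assms prime_gt_1_nat by (auto simp: carmichael_iff)
  hence "n > 0" by (metis gr0I mult_0_right not_less_zero)
  have "p - 1 dvd Carmichael (p * n)"
    using assms pos \<open>n > 0\<close> by (intro prime_minus_1_dvd_Carmichael) auto
  also have "\<dots> dvd p * n - 1"
    using assms by (simp add: carmichael_iff)
  also have "p * n - 1 = (p - 1) * n + (n - 1)"
    using pos \<open>n > 0\<close> by (simp add: diff_mult_distrib)
  finally show ?thesis by (simp add: dvd_add_right_iff)
qed

text \<open>A square factor \<open>p ^ 2\<close> would put \<open>p\<close> into
  \<open>Carmichael m\<close>, hence into \<open>m - 1\<close> as well as \<open>m\<close>.\<close>

lemma carmichael_squarefree:
  assumes "carmichael m"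
  shows "squarefree m"
proof -
  have m: "m > 1" using assms by (simp add: carmichael_iff)
  have "\<not> p ^ 2 dvd m" if p: "prime p" for p
  proof
    assume sq: "p ^ 2 dvd m"
    hence "p dvd m" by (meson dvd_power dvd_trans pos2)
    with prime_minus_1_dvd_Carmichael(2)[OF p _ _ sq] m assms have "p dvd m - 1"
      by (auto simp: carmichael_iff intro: dvd_trans)
    with \<open>p dvd m\<close> m have "p dvd 1" by (metis dvd_diffD1 less_imp_le)
    with p show False by simp
  qed
  with m show ?thesis by (subst squarefree_factorial_semiring) auto
qed

section \<open>Carmichael numbers with three prime factors\<close>

lemma C3_setE:
  assumes "m \<in> C3_set"
  obtains p q r where "prime p" "prime q" "prime r" "p < r" "q < r" "m = r * (p * q)"
proof -
  have m: "carmichael m" "card (prime_factors m) = 3"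
    using assms by (auto simp: C3_set_def C_set_def)
  define r where "r = Max (prime_factors m)"
  have r: "r \<in> prime_factors m"
    unfolding r_def using m by (intro Max_in) auto
  have "card (prime_factors m - {r}) = 2"
    using m r by simp
  then obtain p q where pq: "prime_factors m - {r} = {p, q}" "p \<noteq> q"
    by (auto simp: card_2_iff)
  hence P: "prime_factors m = {r, p, q}" "p \<noteq> r" "q \<noteq> r" using r by auto
  have le: "x \<le> r" if "x \<in> prime_factors m" for x
    unfolding r_def using that by (intro Max_ge) auto
  have less: "p < r" "q < r"
    using le[of p] le[of q] P by auto
  have "m > 0" using m by (simp add: carmichael_def)
  hence "m = (\<Prod>x\<in>prime_factors m. x ^ multiplicity x m)"
    by (simp add: prime_factorization_nat)
  \<comment> \<open>Squarefreeness makes every multiplicity 1.\<close>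
  also have "\<dots> = (\<Prod>x\<in>prime_factors m. x)"
    using carmichael_squarefree[OF m(1)] \<open>m > 0\<close>
    by (intro prod.cong) (auto simp: squarefree_factorial_semiring')
  also have "\<dots> = r * (p * q)"
    using P pq by auto
  finally have "m = r * (p * q)" .
  moreover have "prime p" "prime q" "prime r"
    using P by (metis in_prime_factors_iff insertCI)+
  ultimately show ?thesis using that less by blast
qed

lemma digit_sum_greatest_prime:
  assumes m: "carmichael (r * (p * q))" and p: "prime p" "prime q" "prime r" "p < r" "q < r"
  shows "digit_sum r (r * (p * q)) = r"
proof -
  have gt: "p > 1" "q > 1" "r > 1" using p prime_gt_1_nat by auto
  have "p * q > 1" using gt by (metis less_1_mult)
  from carmichael_prime_dvd[OF m \<open>prime r\<close>] obtain k where "p * q - 1 = (r - 1) * k" ..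
  hence k: "p * q = 1 + (r - 1) * k" using \<open>p * q > 1\<close> by linarith
  \<comment> \<open>The case \<open>k = 1\<close> would give \<open>p * q = r\<close>, a
    prime.\<close>
  have "\<not> prime (p * q)"
    using gt by (metis less_irrefl prime_product mult.commute)
  hence "k \<noteq> 1" using \<open>prime r\<close> gt k by (auto)
  moreover have "k \<noteq> 0" using k \<open>p * q > 1\<close> by (cases k) auto
  moreover have "k \<le> r"
  proof (rule ccontr)
    assume "\<not> k \<le> r"
    \<comment> \<open>\<open>k > r\<close> would push \<open>p * q\<close> up to at least
      \<open>1 + (r - 1) * (r + 1)\<close>, which is \<open>r * r\<close>.\<close>
    hence "(r - 1) * (r + 1) \<le> (r - 1) * k" by (intro mult_left_mono) auto
    moreover have "(r - 1) * (r + 1) + 1 = r * r"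
      using gt by (cases r) (auto simp: algebra_simps)
    moreover have "p * q < r * r" using p by (intro mult_strict_mono) auto
    ultimately show False using k by linarith
  qed
  ultimately obtain j where j: "k = j + 2" "j + 2 \<le> r"
    by (metis One_nat_def Suc_1 add.commute le_Suc_ex less_2_cases not_less)
  then obtain i where i: "r = j + 2 + i" by (metis le_Suc_ex)
  \<comment> \<open>Here \<open>i + 1\<close> is \<open>r + 1 - k\<close> and \<open>j + 1\<close>
    is \<open>k - 1\<close>: the two base-\<open>r\<close> digits of \<open>p * q\<close>, free of
    natural subtraction.\<close>
  have "p * q = (i + 1) + r * (j + 1)"
    unfolding k j i by (simp add: algebra_simps)
  moreover have "digit_sum r ((i + 1) + r * (j + 1)) = (i + 1) + (j + 1)"
    using gt i by (subst digit_sum_add_mult) (auto simp: digit_sum_less)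
  ultimately have "digit_sum r (p * q) = r" by (simp add: i)
  thus ?thesis using gt by (simp add: digit_sum_mult_self)
qed

lemma prime_size_prime_factorization:
  fixes n :: nat
  assumes "size (prime_factorization n) = 1"
  shows "prime n"
proof -
  from assms obtain p where p: "prime_factorization n = {#p#}"
    using size_1_singleton_mset by blast
  hence "n \<noteq> 0" by (metis add_mset_not_empty prime_factorization_0)
  hence "n = p" using prod_mset_prime_factorization_nat[of n] p by simp
  moreover have "prime p" using p by (intro in_prime_factors_imp_prime[of p n]) simp
  ultimately show ?thesis by simp
qed

lemma digit_sum_eq_self_imp_prime:
  assumes m: "m \<in> C3_set" and g: "g dvd m" "1 < g" "g < m" "digit_sum g m = g"
  shows "prime g"
proof (rule ccontr)
  assume np: "\<not> prime g"
  obtain p q r where pqr: "prime p" "prime q" "prime r" "m = r * (p * q)"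
    using m by (rule C3_setE)
  obtain h where h: "m = h * g" using g by (metis dvdE mult.commute)
  have "h \<noteq> 0" "h \<noteq> 1" using h g by auto
  have "prime_factorization m = {#p, q, r#}"
    using pqr by (simp add: prime_factorization_mult prime_factorization_prime prime_gt_0_nat)
  hence "size (prime_factorization h) + size (prime_factorization g) = 3"
    using h \<open>h \<noteq> 0\<close> g by (simp add: prime_factorization_mult flip: size_union)
  moreover have "size (prime_factorization h) \<noteq> 0" "size (prime_factorization g) \<noteq> 0"
    using \<open>h \<noteq> 0\<close> \<open>h \<noteq> 1\<close> g by (auto simp: prime_factorization_empty_iff)
  moreover have "size (prime_factorization g) \<noteq> 1"
    using np prime_size_prime_factorization by blast
  \<comment> \<open>Of three prime factors, a composite \<open>g\<close> takes at least two and
    \<open>h\<close> at least one.\<close>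
  ultimately have "size (prime_factorization h) = 1" by linarith
  hence "prime h" by (rule prime_size_prime_factorization)
  moreover have "carmichael (h * g)" using m h by (auto simp: C3_set_def C_set_def)
  ultimately have "h - 1 dvd g - 1" by (intro carmichael_prime_dvd)
  hence "h \<le> g" using g by (auto dest: dvd_imp_le)
  with np \<open>prime h\<close> have "h < g" by (cases "h = g") auto
  \<comment> \<open>In base \<open>g\<close>, \<open>m\<close> is the single digit \<open>h\<close>
    followed by 0.\<close>
  moreover have "digit_sum g m = digit_sum g h"
    using digit_sum_mult_self[of g h] g h by (simp add: mult.commute)
  ultimately show False using g by (simp add: digit_sum_less)
qed

section \<open>Exclusion from \<open>S_set\<close>\<close>

lemma strict_s_decompositionE:
  assumes dec: "strict_s_decomposition m n g e" and p: "prime p" "p dvd m"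
  obtains h where "p dvd h" "h dvd m" "1 < h" "h < m" "digit_sum h m = h"
proof -
  have eq: "m = (\<Prod>\<nu>=1..n. g \<nu> ^ e \<nu>)"
    using dec by (simp add: strict_s_decomposition_def)
  have "p dvd (\<Prod>\<nu>=1..n. g \<nu> ^ e \<nu>)" using p(2) unfolding eq .
  hence "\<exists>\<nu>\<in>{1..n}. p dvd g \<nu> ^ e \<nu>"
    using p by (subst (asm) prime_dvd_prod_iff) auto
  then obtain \<nu> where \<nu>: "\<nu> \<in> {1..n}" "p dvd g \<nu> ^ e \<nu>" by blast
  hence h: "1 < g \<nu>" "g \<nu> < m" "digit_sum (g \<nu>) m = g \<nu>" "e \<nu> \<ge> 1"
    using dec by (auto simp: strict_s_decomposition_def)
  have "g \<nu> dvd g \<nu> ^ e \<nu>" using h by (simp add: dvd_power)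
  also have "\<dots> dvd m" unfolding eq using \<nu> by (intro dvd_prodI) auto
  finally have "g \<nu> dvd m" .
  moreover have "p dvd g \<nu>" using \<nu> p prime_dvd_power by blast
  ultimately show ?thesis using that h by blast
qed

lemma C3_minus_C'3_subset: "C3_set - C'3_set \<subseteq> L_set - S_set"
proof
  fix m assume "m \<in> C3_set - C'3_set"
  hence C3: "m \<in> C3_set" and np: "\<not> primary_carmichael m"
    by (auto simp: C3_set_def C'3_set_def C'_set_def)
  hence m: "carmichael m" "m > 1" by (auto simp: C3_set_def C_set_def carmichael_def)
  obtain p q r where "prime p" "prime q" "prime r" "p < r" "q < r" "m = r * (p * q)"
    using C3 by (rule C3_setE)
  hence "r dvd m" "digit_sum r m = r"
    using digit_sum_greatest_prime m by auto
  hence "m \<in> L_set" using m by (auto simp: L_set_def)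
  moreover have "m \<notin> S_set"
  proof
    assume "m \<in> S_set"
    then obtain n g e where dec: "strict_s_decomposition m n g e"
      by (auto simp: S_set_def)
    have "digit_sum p m = p" if p: "prime p" "p dvd m" for p
    proof -
      from dec p obtain h where h: "p dvd h" "h dvd m" "1 < h" "h < m" "digit_sum h m = h"
        by (rule strict_s_decompositionE)
      \<comment> \<open>The factor of the decomposition that \<open>p\<close> divides is prime,
        hence \<open>p\<close> itself, and passes its digit sum on to \<open>p\<close>.\<close>
      hence "prime h" using digit_sum_eq_self_imp_prime[OF C3] by blast
      hence "p = h" using p h primes_dvd_imp_eq by blast
      with h show ?thesis by simp
    qed
    with m carmichael_squarefree have "primary_carmichael m"
      by (auto simp: primary_carmichael_def)
    with np show False ..
  qed
  ultimately show "m \<in> L_set - S_set" by blast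
qed

section \<open>The witnesses 6 and 172081\<close>

lemma six_in_L_minus_S: "6 \<in> L_set - S_set"
proof -
  have "digit_sum 2 6 = 2" by (simp add: digit_sum.simps)
  hence "6 \<in> L_set" unfolding L_set_def by (auto intro!: exI[of _ 2])
  moreover have "6 \<notin> S_set"
  proof
    assume "6 \<in> S_set"
    then obtain n g e where dec: "strict_s_decomposition 6 n g e"
      by (auto simp: S_set_def)
    moreover have "prime (3::nat)" "(3::nat) dvd 6" by simp_all
    ultimately obtain h where h: "3 dvd h" "1 < h" "h < 6" "digit_sum h 6 = h"
      by (rule strict_s_decompositionE)
    \<comment> \<open>A decomposition of 6 would need 3 as a factor, but 6 is written 20 in base
      3.\<close>
    hence "h = 3" by presburger
    moreover have "digit_sum 3 6 = 2" by (simp add: digit_sum.simps)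
    ultimately show False using h by simp
  qed
  ultimately show ?thesis by blast
qed

lemma six_notin_C3: "6 \<notin> C3_set"
proof
  assume "6 \<in> C3_set"
  hence "carmichael (3 * 2)" by (simp add: C3_set_def C_set_def)
  hence "(3::nat) - 1 dvd 2 - 1" by (rule carmichael_prime_dvd) simp
  thus False by simp
qed

lemma carmichael_172081: "carmichael 172081"
proof -
  have primes: "prime (7::nat)" "prime (13::nat)" "prime (31::nat)" "prime (61::nat)"
    by simp_all
  have cop: "coprime (31::nat) 61" "coprime (13::nat) (31 * 61)"
    "coprime (7::nat) (13 * (31 * 61))"
    using primes by (auto simp only: coprime_mult_right_iff intro!: primes_coprime)
  have "(172081::nat) = 7 * (13 * (31 * 61))" by simp
  also have "Carmichael \<dots> = lcm 6 (lcm 12 (lcm 30 60))"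
    using primes
    by (simp only: Carmichael_mult_coprime[OF cop(3)] Carmichael_mult_coprime[OF cop(2)]
      Carmichael_mult_coprime[OF cop(1)] Carmichael_prime) simp
  also have "\<dots> = 60"
    by simp
  finally have "Carmichael 172081 = 60" .
  \<comment> \<open>172080 = 60 * 2868.\<close>
  hence "Carmichael 172081 dvd 172081 - 1" by simp
  moreover have "\<not> prime (172081::nat)"
  proof
    assume "prime (172081::nat)"
    moreover have "(7::nat) dvd 172081" by simp
    ultimately have "(7::nat) = 172081" using primes(1) by (intro primes_dvd_imp_eq)
    thus False by simp
  qed
  moreover have "(172081::nat) > 1" by simp
  ultimately show ?thesis unfolding carmichael_iff by blast
qed

lemma not_primary_carmichael_172081: "\<not> primary_carmichael 172081"
proof
  assume "primary_carmichael 172081"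
  moreover have "prime (7::nat)" "(7::nat) dvd 172081" by simp_all
  \<comment> \<open>The base-7 digits 1, 3, 1, 4, 4, 6, 0 in fact add up to 19.\<close>
  ultimately have "digit_sum 7 172081 = 7" unfolding primary_carmichael_def by blast
  thus False by (simp add: digit_sum.simps)
qed

text \<open>With four primes a composite factor can occur: 91 = 7 * 13, in whose base the digits are
  20, 71, 0. Bases 31 and 61 give 5, 24, 2, 0 and 46, 15, 0.\<close>

lemma in_S_172081: "172081 \<in> S_set"
proof -
  let ?g = "\<lambda>\<nu>::nat. if \<nu> = 1 then 31 else if \<nu> = 2 then 61 else 91 :: nat"
  have ivl: "{1..3::nat} = {1, 2, 3}" by auto
  have "digit_sum 31 172081 = 31" "digit_sum 61 172081 = 61" "digit_sum 91 172081 = 91"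
    by (simp_all add: digit_sum.simps)
  hence "strict_s_decomposition 172081 3 ?g (\<lambda>_. 1)"
    unfolding strict_s_decomposition_def ivl strict_mono_on_def by auto
  thus ?thesis unfolding S_set_def by auto
qed

theorem theorem2p4:
  shows "\<not> (C_set - C'_set \<subseteq> L_set - S_set) \<and>
         C3_set - C'3_set \<subset> L_set - S_set"
  using C3_minus_C'3_subset six_in_L_minus_S six_notin_C3
    carmichael_172081 not_primary_carmichael_172081 in_S_172081
  by (auto simp: C_set_def C'_set_def)

end
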